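(* Let $G$ be a group, and let $X$ be the associated heap, i.e. the set $G$ with $[x,y,z]=xy^{-1}z$. Let $A$ be an abelian group and let $\theta:G\times G\to A$ be a normalized group $2$-cocycle with trivial action on $A$. Then $$\eta(x,y,z):=\theta(x,y^{-1})+\theta(xy^{-1},z)-\theta(y,y^{-1})$$ is a PA $2$-cocycle of $X$ with values in $A$. Moreover the construction $\Phi_2(\theta)=\eta$ induces a well-defined map of cohomology groups $\bar\Phi_2:\widehat H^2_G(X)\to H^2_{\rm PA}(X)$ (coefficients in $A$).
   Context: Group side (trivial action on $A$): a 2-cocycle $\theta:G\times G\to A$ satisfies $\theta(x,y)+\theta(xy,z)=\theta(y,z)+\theta(x,yz)$; it is normalized if $\theta(x,1)=0=\theta(1,x)$ for all $x$. The normalized 1-cochain group $\widehat C^1_G(X)$ consists of functions $f:G\to A$ with $f(1)=0$, the normalized 2-cochain group $\widehat C^2_G(X)$ of functions $\theta:G\times G\to A$ with $\theta(x,1)=0=\theta(1,x)$. $\widehat H^2_G(X)$ is the group of normalized 2-cocycles modulo the coboundaries $(x,y)\mapsto f(x)+f(y)-f(xy)$ with $f\in\widehat C^1_G(X)$. Heap side: for $f:X\to A$ put $\delta^1f(x,y,z)=f([x,y,z])-f(x)+f(y)-f(z)$. For $\eta:X^3\to A$ put $\delta^2_{(1)}\eta(x_1,\dots,x_5)=\eta(x_1,x_2,x_3)+\eta([x_1,x_2,x_3],x_4,x_5)+\eta(x_4,x_3,x_2)-\eta(x_1,[x_4,x_3,x_2],x_5)$, $\delta^2_{(2)}\eta(x_1,\dots,x_5)=\eta(x_3,x_4,x_5)+\eta(x_1,x_2,[x_3,x_4,x_5])+\eta(x_4,x_3,x_2)-\eta(x_1,[x_4,x_3,x_2],x_5)$.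 A PA $2$-cocycle is an $\eta$ with $\delta^2_{(1)}\eta=0=\delta^2_{(2)}\eta$; these form $Z^2_{\rm PA}(X,A)$. $B^2_{\rm PA}(X,A)=\mathrm{im}(\delta^1)$ and $H^2_{\rm PA}(X)=H^2_{\rm PA}(X,A)=Z^2_{\rm PA}(X,A)/B^2_{\rm PA}(X,A)$. *)

theory Defs
  imports "HOL-Algebra.Product_Groups"
begin

text \<open>
  The coefficient group \<open>A\<close> is a commutative group in the sense of HOL-Algebra and is therefore
  written multiplicatively, whereas the usual notation in cohomology is additive: \<open>\<otimes>\<close>, \<open>inv\<close> and
  \<open>\<one>\<close> of \<open>A\<close> play the roles of \<open>+\<close>, \<open>-\<close> and \<open>0\<close>.
  An \<open>n\<close>-cochain is a function on \<open>n\<close>-tuples that is \<open>undefined\<close> outside the carrier, so that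
  cochains are equal iff they agree on the carrier.  All cochains on a set \<open>S\<close> form the group
  \<open>product_group S (\<lambda>_. A)\<close> under pointwise multiplication.
\<close>

subsection \<open>Normalized group cohomology in degree two (trivial action)\<close>

definition norm_cochains1 :: "('g, 'm) monoid_scheme \<Rightarrow> ('a, 'n) monoid_scheme \<Rightarrow> ('g \<Rightarrow> 'a) set"
  where "norm_cochains1 G A =
    {f \<in> carrier G \<rightarrow>\<^sub>E carrier A. f \<one>\<^bsub>G\<^esub> = \<one>\<^bsub>A\<^esub>}"

definition norm_cochains2 ::
    "('g, 'm) monoid_scheme \<Rightarrow> ('a, 'n) monoid_scheme \<Rightarrow> ('g \<times> 'g \<Rightarrow> 'a) set"
  where "norm_cochains2 G A =
    {\<theta> \<in> carrier G \<times> carrier G \<rightarrow>\<^sub>E carrier A.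
      \<forall>x\<in>carrier G. \<theta> (x, \<one>\<^bsub>G\<^esub>) = \<one>\<^bsub>A\<^esub> \<and> \<theta> (\<one>\<^bsub>G\<^esub>, x) = \<one>\<^bsub>A\<^esub>}"

definition norm_cocycles2 ::
    "('g, 'm) monoid_scheme \<Rightarrow> ('a, 'n) monoid_scheme \<Rightarrow> ('g \<times> 'g \<Rightarrow> 'a) set"
  where "norm_cocycles2 G A =
    {\<theta> \<in> norm_cochains2 G A. \<forall>x\<in>carrier G. \<forall>y\<in>carrier G. \<forall>z\<in>carrier G.
      \<theta> (x, y) \<otimes>\<^bsub>A\<^esub> \<theta> (x \<otimes>\<^bsub>G\<^esub> y, z) = \<theta> (y, z) \<otimes>\<^bsub>A\<^esub> \<theta> (x, y \<otimes>\<^bsub>G\<^esub> z)}"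

definition group_d1 ::
    "('g, 'm) monoid_scheme \<Rightarrow> ('a, 'n) monoid_scheme \<Rightarrow> ('g \<Rightarrow> 'a) \<Rightarrow> ('g \<times> 'g \<Rightarrow> 'a)"
  where "group_d1 G A f =
    (\<lambda>(x, y)\<in>carrier G \<times> carrier G. f x \<otimes>\<^bsub>A\<^esub> f y \<otimes>\<^bsub>A\<^esub> inv\<^bsub>A\<^esub> f (x \<otimes>\<^bsub>G\<^esub> y))"

definition norm_coboundaries2 ::
    "('g, 'm) monoid_scheme \<Rightarrow> ('a, 'n) monoid_scheme \<Rightarrow> ('g \<times> 'g \<Rightarrow> 'a) set"
  where "norm_coboundaries2 G A = group_d1 G A ` norm_cochains1 G A"

definition norm_Z2 :: "('g, 'm) monoid_scheme \<Rightarrow> ('a, 'n) monoid_scheme \<Rightarrow> ('g \<times> 'g \<Rightarrow> 'a) monoid"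
  where "norm_Z2 G A =
    (product_group (carrier G \<times> carrier G) (\<lambda>_. A))\<lparr>carrier := norm_cocycles2 G A\<rparr>"

definition norm_H2 ::
    "('g, 'm) monoid_scheme \<Rightarrow> ('a, 'n) monoid_scheme \<Rightarrow> ('g \<times> 'g \<Rightarrow> 'a) set monoid"
  where "norm_H2 G A = norm_Z2 G A Mod norm_coboundaries2 G A"

definition norm_class ::
    "('g, 'm) monoid_scheme \<Rightarrow> ('a, 'n) monoid_scheme \<Rightarrow> ('g \<times> 'g \<Rightarrow> 'a) \<Rightarrow> ('g \<times> 'g \<Rightarrow> 'a) set"
  where "norm_class G A \<theta> = norm_coboundaries2 G A #>\<^bsub>norm_Z2 G A\<^esub> \<theta>"

subsection \<open>Heaps and PA cohomology in degree two\<close>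

record 'x heap = "'x partial_object" +
  bracket :: "'x \<Rightarrow> 'x \<Rightarrow> 'x \<Rightarrow> 'x"

definition group_heap :: "('g, 'm) monoid_scheme \<Rightarrow> 'g heap"
  where "group_heap G =
    \<lparr>carrier = carrier G, bracket = (\<lambda>x y z. x \<otimes>\<^bsub>G\<^esub> inv\<^bsub>G\<^esub> y \<otimes>\<^bsub>G\<^esub> z)\<rparr>"

definition triples :: "('x, 'h) heap_scheme \<Rightarrow> ('x \<times> 'x \<times> 'x) set"
  where "triples X = carrier X \<times> carrier X \<times> carrier X"

definition quintuples :: "('x, 'h) heap_scheme \<Rightarrow> ('x \<times> 'x \<times> 'x \<times> 'x \<times> 'x) set"
  where "quintuples X = carrier X \<times> carrier X \<times> carrier X \<times> carrier X \<times> carrier X"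

definition PA_d1 ::
    "('x, 'h) heap_scheme \<Rightarrow> ('a, 'n) monoid_scheme \<Rightarrow> ('x \<Rightarrow> 'a) \<Rightarrow> ('x \<times> 'x \<times> 'x \<Rightarrow> 'a)"
  where "PA_d1 X A f =
    (\<lambda>(x, y, z)\<in>triples X.
      f (bracket X x y z) \<otimes>\<^bsub>A\<^esub> inv\<^bsub>A\<^esub> f x \<otimes>\<^bsub>A\<^esub> f y \<otimes>\<^bsub>A\<^esub> inv\<^bsub>A\<^esub> f z)"

definition PA_d2_1 ::
    "('x, 'h) heap_scheme \<Rightarrow> ('a, 'n) monoid_scheme \<Rightarrow>
      ('x \<times> 'x \<times> 'x \<Rightarrow> 'a) \<Rightarrow> ('x \<times> 'x \<times> 'x \<times> 'x \<times> 'x \<Rightarrow> 'a)"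
  where "PA_d2_1 X A \<eta> =
    (\<lambda>(x1, x2, x3, x4, x5)\<in>quintuples X.
      \<eta> (x1, x2, x3) \<otimes>\<^bsub>A\<^esub> \<eta> (bracket X x1 x2 x3, x4, x5) \<otimes>\<^bsub>A\<^esub> \<eta> (x4, x3, x2)
        \<otimes>\<^bsub>A\<^esub> inv\<^bsub>A\<^esub> \<eta> (x1, bracket X x4 x3 x2, x5))"

definition PA_d2_2 ::
    "('x, 'h) heap_scheme \<Rightarrow> ('a, 'n) monoid_scheme \<Rightarrow>
      ('x \<times> 'x \<times> 'x \<Rightarrow> 'a) \<Rightarrow> ('x \<times> 'x \<times> 'x \<times> 'x \<times> 'x \<Rightarrow> 'a)"
  where "PA_d2_2 X A \<eta> =
    (\<lambda>(x1, x2, x3, x4, x5)\<in>quintuples X.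
      \<eta> (x3, x4, x5) \<otimes>\<^bsub>A\<^esub> \<eta> (x1, x2, bracket X x3 x4 x5) \<otimes>\<^bsub>A\<^esub> \<eta> (x4, x3, x2)
        \<otimes>\<^bsub>A\<^esub> inv\<^bsub>A\<^esub> \<eta> (x1, bracket X x4 x3 x2, x5))"

definition PA_cocycles2 ::
    "('x, 'h) heap_scheme \<Rightarrow> ('a, 'n) monoid_scheme \<Rightarrow> ('x \<times> 'x \<times> 'x \<Rightarrow> 'a) set"
  where "PA_cocycles2 X A =
    {\<eta> \<in> triples X \<rightarrow>\<^sub>E carrier A.
      PA_d2_1 X A \<eta> = (\<lambda>_\<in>quintuples X. \<one>\<^bsub>A\<^esub>) \<and> PA_d2_2 X A \<eta> = (\<lambda>_\<in>quintuples X. \<one>\<^bsub>A\<^esub>)}"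

definition PA_coboundaries2 ::
    "('x, 'h) heap_scheme \<Rightarrow> ('a, 'n) monoid_scheme \<Rightarrow> ('x \<times> 'x \<times> 'x \<Rightarrow> 'a) set"
  where "PA_coboundaries2 X A = PA_d1 X A ` (carrier X \<rightarrow>\<^sub>E carrier A)"

definition PA_Z2 ::
    "('x, 'h) heap_scheme \<Rightarrow> ('a, 'n) monoid_scheme \<Rightarrow> ('x \<times> 'x \<times> 'x \<Rightarrow> 'a) monoid"
  where "PA_Z2 X A = (product_group (triples X) (\<lambda>_. A))\<lparr>carrier := PA_cocycles2 X A\<rparr>"

definition PA_H2 ::
    "('x, 'h) heap_scheme \<Rightarrow> ('a, 'n) monoid_scheme \<Rightarrow> ('x \<times> 'x \<times> 'x \<Rightarrow> 'a) set monoid"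
  where "PA_H2 X A = PA_Z2 X A Mod PA_coboundaries2 X A"

definition PA_class ::
    "('x, 'h) heap_scheme \<Rightarrow> ('a, 'n) monoid_scheme \<Rightarrow>
      ('x \<times> 'x \<times> 'x \<Rightarrow> 'a) \<Rightarrow> ('x \<times> 'x \<times> 'x \<Rightarrow> 'a) set"
  where "PA_class X A \<eta> = PA_coboundaries2 X A #>\<^bsub>PA_Z2 X A\<^esub> \<eta>"

subsection \<open>From group cochains to heap cochains\<close>

definition Phi2 ::
    "('g, 'm) monoid_scheme \<Rightarrow> ('a, 'n) monoid_scheme \<Rightarrow> ('g \<times> 'g \<Rightarrow> 'a) \<Rightarrow> ('g \<times> 'g \<times> 'g \<Rightarrow> 'a)"
  where "Phi2 G A \<theta> =
    (\<lambda>(x, y, z)\<in>triples (group_heap G).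
      \<theta> (x, inv\<^bsub>G\<^esub> y) \<otimes>\<^bsub>A\<^esub> \<theta> (x \<otimes>\<^bsub>G\<^esub> inv\<^bsub>G\<^esub> y, z) \<otimes>\<^bsub>A\<^esub> inv\<^bsub>A\<^esub> \<theta> (y, inv\<^bsub>G\<^esub> y))"

subsection \<open>The quotients above are groups\<close>

text \<open>
  \<open>Mod\<close> is defined for arbitrary subsets, so the following lemmas record that cocycles form
  groups and that coboundaries are subgroups of them.
\<close>

lemma comm_group_cochains:
  assumes "comm_group A" shows "comm_group (product_group S (\<lambda>_. A))"
proof -
  interpret A: comm_group A by fact
  interpret P: group "product_group S (\<lambda>_. A)" by simp
  show ?thesis
    by (rule P.group_comm_groupI) (auto simp: PiE_iff A.m_comm intro!: restrict_ext)
qed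

lemma subgroup_comm_group:
  assumes "comm_group K" "subgroup Z K" "subgroup B K" "B \<subseteq> Z"
  shows "comm_group (K\<lparr>carrier := Z\<rparr>)" "subgroup B (K\<lparr>carrier := Z\<rparr>)"
    "comm_group (K\<lparr>carrier := Z\<rparr> Mod B)"
proof -
  interpret K: comm_group K by fact
  show c: "comm_group (K\<lparr>carrier := Z\<rparr>)"
    by (rule group.group_comm_groupI[OF K.subgroup_imp_group[OF assms(2)]])
      (use subgroup.mem_carrier[OF assms(2)] in \<open>auto simp: K.m_comm\<close>)
  show s: "subgroup B (K\<lparr>carrier := Z\<rparr>)"
    using assms K.subgroup_incl by blast
  show "comm_group (K\<lparr>carrier := Z\<rparr> Mod B)"
    by (rule comm_group.abelian_FactGroup[OF c s])
qed

lemma norm_cocycles2_subgroup: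
  assumes "group G" "comm_group A"
  shows "subgroup (norm_cocycles2 G A) (product_group (carrier G \<times> carrier G) (\<lambda>_. A))"
proof -
  interpret G: group G by fact
  interpret A: comm_group A by fact
  let ?P = "product_group (carrier G \<times> carrier G) (\<lambda>_. A)"
  interpret P: group ?P by simp
  show ?thesis
  proof (rule P.subgroupI)
    show "norm_cocycles2 G A \<subseteq> carrier ?P"
      by (auto simp: norm_cocycles2_def norm_cochains2_def)
    have "\<one>\<^bsub>?P\<^esub> \<in> norm_cocycles2 G A"
      by (auto simp: norm_cocycles2_def norm_cochains2_def)
    then show "norm_cocycles2 G A \<noteq> {}" by blast
  next
    fix t assume t: "t \<in> norm_cocycles2 G A"
    then have tc: "t \<in> carrier G \<times> carrier G \<rightarrow>\<^sub>E carrier A"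
      by (simp add: norm_cocycles2_def norm_cochains2_def)
    then have c: "t (x, y) \<in> carrier A" if "x \<in> carrier G" "y \<in> carrier G" for x y
      using that by (auto simp: PiE_iff)
    have coc: "inv\<^bsub>A\<^esub> t (x, y) \<otimes>\<^bsub>A\<^esub> inv\<^bsub>A\<^esub> t (x \<otimes>\<^bsub>G\<^esub> y, z)
        = inv\<^bsub>A\<^esub> t (y, z) \<otimes>\<^bsub>A\<^esub> inv\<^bsub>A\<^esub> t (x, y \<otimes>\<^bsub>G\<^esub> z)"
      if "x \<in> carrier G" "y \<in> carrier G" "z \<in> carrier G" for x y z
      using t that by (simp add: c norm_cocycles2_def flip: A.inv_mult)
    have "inv\<^bsub>?P\<^esub> t = (\<lambda>i\<in>carrier G \<times> carrier G. inv\<^bsub>A\<^esub> t i)"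
      using tc by simp
    then show "inv\<^bsub>?P\<^esub> t \<in> norm_cocycles2 G A"
      using t coc c by (auto simp: norm_cocycles2_def norm_cochains2_def)
  next
    fix s t assume st: "s \<in> norm_cocycles2 G A" "t \<in> norm_cocycles2 G A"
    then have c: "s (x, y) \<in> carrier A" "t (x, y) \<in> carrier A"
      if "x \<in> carrier G" "y \<in> carrier G" for x y
      using that by (auto simp: norm_cocycles2_def norm_cochains2_def)
    have coc: "(s (x, y) \<otimes>\<^bsub>A\<^esub> t (x, y)) \<otimes>\<^bsub>A\<^esub> (s (x \<otimes>\<^bsub>G\<^esub> y, z) \<otimes>\<^bsub>A\<^esub> t (x \<otimes>\<^bsub>G\<^esub> y, z))
        = (s (y, z) \<otimes>\<^bsub>A\<^esub> t (y, z)) \<otimes>\<^bsub>A\<^esub> (s (x, y \<otimes>\<^bsub>G\<^esub> z) \<otimes>\<^bsub>A\<^esub> t (x, y \<otimes>\<^bsub>G\<^esub> z))"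
      (is "(?a \<otimes>\<^bsub>A\<^esub> ?b) \<otimes>\<^bsub>A\<^esub> (?c \<otimes>\<^bsub>A\<^esub> ?d) = (?e \<otimes>\<^bsub>A\<^esub> ?f) \<otimes>\<^bsub>A\<^esub> (?g \<otimes>\<^bsub>A\<^esub> ?h)")
      if "x \<in> carrier G" "y \<in> carrier G" "z \<in> carrier G" for x y z
    proof -
      have "(?a \<otimes>\<^bsub>A\<^esub> ?b) \<otimes>\<^bsub>A\<^esub> (?c \<otimes>\<^bsub>A\<^esub> ?d) = (?a \<otimes>\<^bsub>A\<^esub> ?c) \<otimes>\<^bsub>A\<^esub> (?b \<otimes>\<^bsub>A\<^esub> ?d)"
        using that c by (simp add: A.m_ac)
      also have "\<dots> = (?e \<otimes>\<^bsub>A\<^esub> ?g) \<otimes>\<^bsub>A\<^esub> (?f \<otimes>\<^bsub>A\<^esub> ?h)"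
        using that st by (simp add: norm_cocycles2_def)
      also have "\<dots> = (?e \<otimes>\<^bsub>A\<^esub> ?f) \<otimes>\<^bsub>A\<^esub> (?g \<otimes>\<^bsub>A\<^esub> ?h)"
        using that c by (simp add: A.m_ac)
      finally show ?thesis .
    qed
    show "s \<otimes>\<^bsub>?P\<^esub> t \<in> norm_cocycles2 G A"
      using st coc c by (auto simp: norm_cocycles2_def norm_cochains2_def)
  qed
qed

lemma norm_coboundaries2_subgroup:
  assumes "group G" "comm_group A"
  shows "subgroup (norm_coboundaries2 G A) (product_group (carrier G \<times> carrier G) (\<lambda>_. A))"
proof -
  interpret G: group G by fact
  interpret A: comm_group A by fact
  let ?P = "product_group (carrier G \<times> carrier G) (\<lambda>_. A)"
  let ?Q = "product_group (carrier G) (\<lambda>_. A)"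
  interpret P: group ?P by simp
  interpret Q: group ?Q by simp
  have m: "f x \<in> carrier A" if "f \<in> carrier G \<rightarrow>\<^sub>E carrier A" "x \<in> carrier G" for f x
    using that by auto
  have "group_d1 G A \<in> hom ?Q ?P"
  proof (rule homI)
    fix f assume f: "f \<in> carrier ?Q"
    then show "group_d1 G A f \<in> carrier ?P"
      by (auto simp: group_d1_def)
  next
    fix f g assume "f \<in> carrier ?Q" "g \<in> carrier ?Q"
    then have fg: "f \<in> carrier G \<rightarrow>\<^sub>E carrier A" "g \<in> carrier G \<rightarrow>\<^sub>E carrier A" by auto
    show "group_d1 G A (f \<otimes>\<^bsub>?Q\<^esub> g) = group_d1 G A f \<otimes>\<^bsub>?P\<^esub> group_d1 G A g"
      using m[OF fg(1)] m[OF fg(2)] by (auto simp: group_d1_def fun_eq_iff A.inv_mult A.m_ac)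
  qed
  then interpret h: group_hom ?Q ?P "group_d1 G A"
    by unfold_locales
  have "subgroup (norm_cochains1 G A) ?Q"
  proof (rule Q.subgroupI)
    show "norm_cochains1 G A \<subseteq> carrier ?Q"
      by (auto simp: norm_cochains1_def)
    have "\<one>\<^bsub>?Q\<^esub> \<in> norm_cochains1 G A"
      by (auto simp: norm_cochains1_def)
    then show "norm_cochains1 G A \<noteq> {}" by blast
  qed (auto simp: norm_cochains1_def)
  then show ?thesis
    unfolding norm_coboundaries2_def by (rule h.subgroup_img_is_subgroup)
qed

lemma norm_coboundaries2_subset:
  assumes "group G" "comm_group A"
  shows "norm_coboundaries2 G A \<subseteq> norm_cocycles2 G A"
proof -
  interpret G: group G by fact
  interpret A: comm_group A by fact
  have "group_d1 G A f \<in> norm_cocycles2 G A" if f: "f \<in> norm_cochains1 G A" for f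
  proof -
    have c: "f x \<in> carrier A" if "x \<in> carrier G" for x
      using f that by (auto simp: norm_cochains1_def)
    have "f \<one>\<^bsub>G\<^esub> = \<one>\<^bsub>A\<^esub>"
      using f by (simp add: norm_cochains1_def)
    then have n: "group_d1 G A f \<in> norm_cochains2 G A"
      using c by (auto simp: group_d1_def norm_cochains2_def)
    have "group_d1 G A f (x, y) \<otimes>\<^bsub>A\<^esub> group_d1 G A f (x \<otimes>\<^bsub>G\<^esub> y, z)
        = group_d1 G A f (y, z) \<otimes>\<^bsub>A\<^esub> group_d1 G A f (x, y \<otimes>\<^bsub>G\<^esub> z)"
      if xyz: "x \<in> carrier G" "y \<in> carrier G" "z \<in> carrier G" for x y z
    proof -
      have e: "(a \<otimes>\<^bsub>A\<^esub> b \<otimes>\<^bsub>A\<^esub> inv\<^bsub>A\<^esub> p) \<otimes>\<^bsub>A\<^esub> (p \<otimes>\<^bsub>A\<^esub> c \<otimes>\<^bsub>A\<^esub> inv\<^bsub>A\<^esub> r)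
          = a \<otimes>\<^bsub>A\<^esub> b \<otimes>\<^bsub>A\<^esub> c \<otimes>\<^bsub>A\<^esub> inv\<^bsub>A\<^esub> r" (is "?l = ?r")
        if "a \<in> carrier A" "b \<in> carrier A" "c \<in> carrier A" "p \<in> carrier A" "r \<in> carrier A"
        for a b c p r
      proof -
        have "?l = (p \<otimes>\<^bsub>A\<^esub> inv\<^bsub>A\<^esub> p) \<otimes>\<^bsub>A\<^esub> ?r"
          using that by (simp only: A.m_ac A.m_closed A.inv_closed)
        then show ?thesis using that by simp
      qed
      show ?thesis
        using xyz c e[of "f x" "f y" "f z" "f (x \<otimes>\<^bsub>G\<^esub> y)" "f (x \<otimes>\<^bsub>G\<^esub> y \<otimes>\<^bsub>G\<^esub> z)"]
          e[of "f y" "f z" "f x" "f (y \<otimes>\<^bsub>G\<^esub> z)" "f (x \<otimes>\<^bsub>G\<^esub> y \<otimes>\<^bsub>G\<^esub> z)"]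
        by (simp add: group_d1_def G.m_assoc A.m_ac)
    qed
    with n show ?thesis by (simp add: norm_cocycles2_def)
  qed
  then show ?thesis by (auto simp: norm_coboundaries2_def)
qed

lemma comm_group_norm_H2:
  assumes "group G" "comm_group A"
  shows "comm_group (norm_Z2 G A)" "subgroup (norm_coboundaries2 G A) (norm_Z2 G A)"
    "comm_group (norm_H2 G A)"
  using subgroup_comm_group[OF comm_group_cochains[OF assms(2)] norm_cocycles2_subgroup[OF assms]
      norm_coboundaries2_subgroup[OF assms] norm_coboundaries2_subset[OF assms]]
  by (simp_all add: norm_Z2_def norm_H2_def)

locale heap =
  fixes X :: "('x, 'h) heap_scheme"
  assumes closed:
      "\<lbrakk>x \<in> carrier X; y \<in> carrier X; z \<in> carrier X\<rbrakk> \<Longrightarrow> bracket X x y z \<in> carrier X"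
    and para_assoc_left:
      "\<lbrakk>x1 \<in> carrier X; x2 \<in> carrier X; x3 \<in> carrier X; x4 \<in> carrier X; x5 \<in> carrier X\<rbrakk>
        \<Longrightarrow> bracket X (bracket X x1 x2 x3) x4 x5 = bracket X x1 (bracket X x4 x3 x2) x5"
    and para_assoc_right:
      "\<lbrakk>x1 \<in> carrier X; x2 \<in> carrier X; x3 \<in> carrier X; x4 \<in> carrier X; x5 \<in> carrier X\<rbrakk>
        \<Longrightarrow> bracket X x1 x2 (bracket X x3 x4 x5) = bracket X x1 (bracket X x4 x3 x2) x5"
    and degenerate_left: "\<lbrakk>x \<in> carrier X; y \<in> carrier X\<rbrakk> \<Longrightarrow> bracket X x x y = y"
    and degenerate_right: "\<lbrakk>x \<in> carrier X; y \<in> carrier X\<rbrakk> \<Longrightarrow> bracket X y x x = y"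

lemma heap_group_heap:
  assumes "group G" shows "heap (group_heap G)"
proof -
  interpret G: group G by fact
  show ?thesis
    by unfold_locales
      (auto simp: group_heap_def G.m_assoc G.inv_mult_group G.inv_solve_left)
qed

context heap
begin

lemma PA_d1_hom:
  assumes "comm_group A"
  shows "PA_d1 X A \<in> hom (product_group (carrier X) (\<lambda>_. A)) (product_group (triples X) (\<lambda>_. A))"
    (is "_ \<in> hom ?Q ?P")
proof (rule homI)
  interpret A: comm_group A by fact
  have m: "f x \<in> carrier A" if "f \<in> carrier X \<rightarrow>\<^sub>E carrier A" "x \<in> carrier X" for f x
    using that by auto
  fix f assume "f \<in> carrier ?Q"
  then have f: "f \<in> carrier X \<rightarrow>\<^sub>E carrier A" by simp
  show "PA_d1 X A f \<in> carrier ?P"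
    using m[OF f] by (auto simp: PA_d1_def triples_def closed)
  fix g assume "g \<in> carrier ?Q"
  then have g: "g \<in> carrier X \<rightarrow>\<^sub>E carrier A" by simp
  show "PA_d1 X A (f \<otimes>\<^bsub>?Q\<^esub> g) = PA_d1 X A f \<otimes>\<^bsub>?P\<^esub> PA_d1 X A g"
    using m[OF f] m[OF g]
    by (auto simp: PA_d1_def triples_def fun_eq_iff closed A.inv_mult A.m_ac)
qed

lemma PA_d2_hom:
  assumes "comm_group A"
  shows "PA_d2_1 X A \<in> hom (product_group (triples X) (\<lambda>_. A)) (product_group (quintuples X) (\<lambda>_. A))"
    and "PA_d2_2 X A \<in> hom (product_group (triples X) (\<lambda>_. A)) (product_group (quintuples X) (\<lambda>_. A))"
    (is "_ \<in> hom ?P ?R")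
proof -
  interpret A: comm_group A by fact
  have m: "f (x, y, z) \<in> carrier A"
    if "f \<in> carrier ?P" "x \<in> carrier X" "y \<in> carrier X" "z \<in> carrier X" for f x y z
    using that by (auto simp: triples_def)
  show "PA_d2_1 X A \<in> hom ?P ?R"
  proof (rule homI)
    fix f assume f: "f \<in> carrier ?P"
    show "PA_d2_1 X A f \<in> carrier ?R"
      using m[OF f] by (auto simp: PA_d2_1_def quintuples_def closed)
    fix g assume g: "g \<in> carrier ?P"
    show "PA_d2_1 X A (f \<otimes>\<^bsub>?P\<^esub> g) = PA_d2_1 X A f \<otimes>\<^bsub>?R\<^esub> PA_d2_1 X A g"
      using m[OF f] m[OF g]
      by (auto simp: PA_d2_1_def triples_def quintuples_def fun_eq_iff closed A.inv_mult A.m_ac)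
  qed
  show "PA_d2_2 X A \<in> hom ?P ?R"
  proof (rule homI)
    fix f assume f: "f \<in> carrier ?P"
    show "PA_d2_2 X A f \<in> carrier ?R"
      using m[OF f] by (auto simp: PA_d2_2_def quintuples_def closed)
    fix g assume g: "g \<in> carrier ?P"
    show "PA_d2_2 X A (f \<otimes>\<^bsub>?P\<^esub> g) = PA_d2_2 X A f \<otimes>\<^bsub>?R\<^esub> PA_d2_2 X A g"
      using m[OF f] m[OF g]
      by (auto simp: PA_d2_2_def triples_def quintuples_def fun_eq_iff closed A.inv_mult A.m_ac)
  qed
qed

lemma PA_cocycles2_subgroup:
  assumes "comm_group A"
  shows "subgroup (PA_cocycles2 X A) (product_group (triples X) (\<lambda>_. A))"
proof -
  interpret A: comm_group A by fact
  let ?P = "product_group (triples X) (\<lambda>_. A)" and ?R = "product_group (quintuples X) (\<lambda>_. A)"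
  interpret P: group ?P by simp
  interpret R: group ?R by simp
  interpret h1: group_hom ?P ?R "PA_d2_1 X A"
    by unfold_locales (rule PA_d2_hom[OF assms])
  interpret h2: group_hom ?P ?R "PA_d2_2 X A"
    by unfold_locales (rule PA_d2_hom[OF assms])
  have "PA_cocycles2 X A = kernel ?P ?R (PA_d2_1 X A) \<inter> kernel ?P ?R (PA_d2_2 X A)"
    by (auto simp: PA_cocycles2_def kernel_def)
  then show ?thesis
    using P.subgroups_Inter_pair[OF h1.subgroup_kernel h2.subgroup_kernel] by simp
qed

lemma PA_coboundaries2_subgroup:
  assumes "comm_group A"
  shows "subgroup (PA_coboundaries2 X A) (product_group (triples X) (\<lambda>_. A))"
proof -
  interpret A: comm_group A by fact
  let ?P = "product_group (triples X) (\<lambda>_. A)" and ?Q = "product_group (carrier X) (\<lambda>_. A)"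
  interpret P: group ?P by simp
  interpret Q: group ?Q by simp
  interpret h: group_hom ?Q ?P "PA_d1 X A"
    by unfold_locales (rule PA_d1_hom[OF assms])
  show ?thesis
    using h.img_is_subgroup by (simp add: PA_coboundaries2_def)
qed

lemma PA_coboundaries2_subset:
  assumes "comm_group A"
  shows "PA_coboundaries2 X A \<subseteq> PA_cocycles2 X A"
proof -
  interpret A: comm_group A by fact
  have "PA_d1 X A f \<in> PA_cocycles2 X A" if f: "f \<in> carrier X \<rightarrow>\<^sub>E carrier A" for f
  proof -
    have c: "f x \<in> carrier A" if "x \<in> carrier X" for x
      using f that by auto
    have e: "(p \<otimes>\<^bsub>A\<^esub> inv\<^bsub>A\<^esub> a1 \<otimes>\<^bsub>A\<^esub> a2 \<otimes>\<^bsub>A\<^esub> inv\<^bsub>A\<^esub> a3)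
        \<otimes>\<^bsub>A\<^esub> (r \<otimes>\<^bsub>A\<^esub> inv\<^bsub>A\<^esub> p \<otimes>\<^bsub>A\<^esub> a4 \<otimes>\<^bsub>A\<^esub> inv\<^bsub>A\<^esub> a5)
        \<otimes>\<^bsub>A\<^esub> (q \<otimes>\<^bsub>A\<^esub> inv\<^bsub>A\<^esub> a4 \<otimes>\<^bsub>A\<^esub> a3 \<otimes>\<^bsub>A\<^esub> inv\<^bsub>A\<^esub> a2)
        \<otimes>\<^bsub>A\<^esub> inv\<^bsub>A\<^esub> (r \<otimes>\<^bsub>A\<^esub> inv\<^bsub>A\<^esub> a1 \<otimes>\<^bsub>A\<^esub> q \<otimes>\<^bsub>A\<^esub> inv\<^bsub>A\<^esub> a5) = \<one>\<^bsub>A\<^esub>" (is "?l = _")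
      and e': "(p \<otimes>\<^bsub>A\<^esub> inv\<^bsub>A\<^esub> a3 \<otimes>\<^bsub>A\<^esub> a4 \<otimes>\<^bsub>A\<^esub> inv\<^bsub>A\<^esub> a5)
        \<otimes>\<^bsub>A\<^esub> (r \<otimes>\<^bsub>A\<^esub> inv\<^bsub>A\<^esub> a1 \<otimes>\<^bsub>A\<^esub> a2 \<otimes>\<^bsub>A\<^esub> inv\<^bsub>A\<^esub> p)
        \<otimes>\<^bsub>A\<^esub> (q \<otimes>\<^bsub>A\<^esub> inv\<^bsub>A\<^esub> a4 \<otimes>\<^bsub>A\<^esub> a3 \<otimes>\<^bsub>A\<^esub> inv\<^bsub>A\<^esub> a2)
        \<otimes>\<^bsub>A\<^esub> inv\<^bsub>A\<^esub> (r \<otimes>\<^bsub>A\<^esub> inv\<^bsub>A\<^esub> a1 \<otimes>\<^bsub>A\<^esub> q \<otimes>\<^bsub>A\<^esub> inv\<^bsub>A\<^esub> a5) = \<one>\<^bsub>A\<^esub>" (is "?l' = _")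
      if v: "a1 \<in> carrier A" "a2 \<in> carrier A" "a3 \<in> carrier A" "a4 \<in> carrier A" "a5 \<in> carrier A"
        "p \<in> carrier A" "q \<in> carrier A" "r \<in> carrier A" for a1 a2 a3 a4 a5 p q r
    proof -
      let ?s = "(p \<otimes>\<^bsub>A\<^esub> inv\<^bsub>A\<^esub> p) \<otimes>\<^bsub>A\<^esub> (a2 \<otimes>\<^bsub>A\<^esub> inv\<^bsub>A\<^esub> a2) \<otimes>\<^bsub>A\<^esub> (a3 \<otimes>\<^bsub>A\<^esub> inv\<^bsub>A\<^esub> a3)
        \<otimes>\<^bsub>A\<^esub> (a4 \<otimes>\<^bsub>A\<^esub> inv\<^bsub>A\<^esub> a4)
        \<otimes>\<^bsub>A\<^esub> ((r \<otimes>\<^bsub>A\<^esub> inv\<^bsub>A\<^esub> a1 \<otimes>\<^bsub>A\<^esub> q \<otimes>\<^bsub>A\<^esub> inv\<^bsub>A\<^esub> a5)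
          \<otimes>\<^bsub>A\<^esub> inv\<^bsub>A\<^esub> (r \<otimes>\<^bsub>A\<^esub> inv\<^bsub>A\<^esub> a1 \<otimes>\<^bsub>A\<^esub> q \<otimes>\<^bsub>A\<^esub> inv\<^bsub>A\<^esub> a5))"
      have "?l = ?s" "?l' = ?s"
        using v by (simp_all only: A.m_ac A.m_closed A.inv_closed)
      moreover have "?s = \<one>\<^bsub>A\<^esub>"
        using v by (simp only: A.r_inv A.m_closed A.inv_closed A.r_one A.one_closed)
      ultimately show "?l = \<one>\<^bsub>A\<^esub>" "?l' = \<one>\<^bsub>A\<^esub>" by simp_all
    qed
    have "PA_d1 X A f \<in> triples X \<rightarrow>\<^sub>E carrier A"
      using c by (auto simp: PA_d1_def triples_def closed)
    moreover have "PA_d2_1 X A (PA_d1 X A f) = (\<lambda>_\<in>quintuples X. \<one>\<^bsub>A\<^esub>)"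
      unfolding PA_d2_1_def
      by (rule restrict_ext)
        (auto simp: quintuples_def triples_def PA_d1_def closed para_assoc_left intro!: e c)
    moreover have "PA_d2_2 X A (PA_d1 X A f) = (\<lambda>_\<in>quintuples X. \<one>\<^bsub>A\<^esub>)"
      unfolding PA_d2_2_def
      by (rule restrict_ext)
        (auto simp: quintuples_def triples_def PA_d1_def closed para_assoc_right intro!: e' c)
    ultimately show ?thesis by (simp add: PA_cocycles2_def)
  qed
  then show ?thesis by (auto simp: PA_coboundaries2_def)
qed

lemma comm_group_PA_H2:
  assumes "comm_group A"
  shows "comm_group (PA_Z2 X A)" "subgroup (PA_coboundaries2 X A) (PA_Z2 X A)"
    "comm_group (PA_H2 X A)"
  using subgroup_comm_group[OF comm_group_cochains[OF assms] PA_cocycles2_subgroup[OF assms]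
      PA_coboundaries2_subgroup[OF assms] PA_coboundaries2_subset[OF assms]]
  by (simp_all add: PA_Z2_def PA_H2_def)

end

end

theory Submission
  imports Defs
begin

text \<open>
  A normalized cocycle \<open>\<theta>\<close> turns \<open>A \<times> G\<close> into a group \<open>E\<close>, the central extension of \<open>G\<close> by \<open>A\<close>
  classified by \<open>\<theta>\<close>. In the heap of \<open>E\<close>, the set-theoretic section \<open>s x = (\<one>, x)\<close> fails to preserve
  brackets by exactly the central factor \<open>\<eta> = Phi2 G A \<theta>\<close>:
  \<open>[s x, s y, s z] = \<eta> (x, y, z) \<cdot> s [x, y, z]\<close> (\<open>bracket_central_extension\<close>). Since the heap of any
  group is para-associative, a five-fold bracket of section values has the same \<open>A\<close>-component however
  it is nested, and comparing the nestings yields the two PA cocycle conditions for \<open>\<eta>\<close>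
  (\<open>Phi2_cocycle\<close>). The group cocycle identity enters only through the associativity of \<open>E\<close>.

  For cohomology, \<open>Phi2\<close> is pointwise a product of values of \<open>\<theta>\<close> and their inverses, hence a
  homomorphism of cocycle groups (\<open>Phi2_hom\<close>), and it carries the coboundary of \<open>f\<close> to the PA
  coboundary of the pointwise inverse of \<open>f\<close> (\<open>Phi2_group_d1\<close>); the inversion comes from the opposite
  sign conventions of the two first coboundary maps. The universal property of quotient groups then
  gives the induced map, which is unique because every cohomology class is the class of a cocycle.
\<close>

section \<open>The central extension of a normalized cocycle\<close>

definition central_extension ::
    "('g, 'm) monoid_scheme \<Rightarrow> ('a, 'n) monoid_scheme \<Rightarrow> ('g \<times> 'g \<Rightarrow> 'a) \<Rightarrow> ('a \<times> 'g) monoid"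
  where "central_extension G A \<theta> =
    \<lparr>carrier = carrier A \<times> carrier G,
     monoid.mult = (\<lambda>(a, x) (b, y). (a \<otimes>\<^bsub>A\<^esub> b \<otimes>\<^bsub>A\<^esub> \<theta> (x, y), x \<otimes>\<^bsub>G\<^esub> y)),
     one = (\<one>\<^bsub>A\<^esub>, \<one>\<^bsub>G\<^esub>)\<rparr>"

lemma central_extension_simps [simp]:
  "carrier (central_extension G A \<theta>) = carrier A \<times> carrier G"
  "(a, x) \<otimes>\<^bsub>central_extension G A \<theta>\<^esub> (b, y) = (a \<otimes>\<^bsub>A\<^esub> b \<otimes>\<^bsub>A\<^esub> \<theta> (x, y), x \<otimes>\<^bsub>G\<^esub> y)"
  "\<one>\<^bsub>central_extension G A \<theta>\<^esub> = (\<one>\<^bsub>A\<^esub>, \<one>\<^bsub>G\<^esub>)"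
  by (simp_all add: central_extension_def)

lemma group_heap_simps [simp]:
  "carrier (group_heap G) = carrier G"
  "bracket (group_heap G) x y z = x \<otimes>\<^bsub>G\<^esub> inv\<^bsub>G\<^esub> y \<otimes>\<^bsub>G\<^esub> z"
  by (simp_all add: group_heap_def)

lemma norm_cocycles2_closed:
  assumes "\<theta> \<in> norm_cocycles2 G A" "x \<in> carrier G" "y \<in> carrier G"
  shows "\<theta> (x, y) \<in> carrier A"
  using assms by (auto simp: norm_cocycles2_def norm_cochains2_def)

lemma norm_cocycles2_one:
  assumes "\<theta> \<in> norm_cocycles2 G A" "x \<in> carrier G"
  shows "\<theta> (x, \<one>\<^bsub>G\<^esub>) = \<one>\<^bsub>A\<^esub>" "\<theta> (\<one>\<^bsub>G\<^esub>, x) = \<one>\<^bsub>A\<^esub>"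
  using assms by (auto simp: norm_cocycles2_def norm_cochains2_def)

lemma norm_cocycles2_cocycle:
  assumes "\<theta> \<in> norm_cocycles2 G A" "x \<in> carrier G" "y \<in> carrier G" "z \<in> carrier G"
  shows "\<theta> (x, y) \<otimes>\<^bsub>A\<^esub> \<theta> (x \<otimes>\<^bsub>G\<^esub> y, z) = \<theta> (y, z) \<otimes>\<^bsub>A\<^esub> \<theta> (x, y \<otimes>\<^bsub>G\<^esub> z)"
  using assms by (simp add: norm_cocycles2_def)

text \<open>
  Associativity is the cocycle identity, the unit laws are normalization.
\<close>

lemma group_central_extension:
  assumes "group G" "comm_group A" and \<theta>: "\<theta> \<in> norm_cocycles2 G A"
  shows "group (central_extension G A \<theta>)" (is "group ?E")
proof -
  interpret G: group G by fact
  interpret A: comm_group A by fact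
  note c = norm_cocycles2_closed[OF \<theta>]
  show ?thesis
  proof (rule groupI)
    show "u \<otimes>\<^bsub>?E\<^esub> v \<in> carrier ?E" if "u \<in> carrier ?E" "v \<in> carrier ?E" for u v
      using that c by (cases u; cases v) simp
    show "\<one>\<^bsub>?E\<^esub> \<otimes>\<^bsub>?E\<^esub> u = u" if "u \<in> carrier ?E" for u
      using that norm_cocycles2_one[OF \<theta>] by (cases u) simp
  next
    fix u v w assume uvw: "u \<in> carrier ?E" "v \<in> carrier ?E" "w \<in> carrier ?E"
    obtain a x b y d z where e: "u = (a, x)" "v = (b, y)" "w = (d, z)"
      by (cases u; cases v; cases w)
    with uvw have m: "a \<in> carrier A" "b \<in> carrier A" "d \<in> carrier A"
      and xyz: "x \<in> carrier G" "y \<in> carrier G" "z \<in> carrier G" by auto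
    have "a \<otimes>\<^bsub>A\<^esub> b \<otimes>\<^bsub>A\<^esub> \<theta> (x, y) \<otimes>\<^bsub>A\<^esub> d \<otimes>\<^bsub>A\<^esub> \<theta> (x \<otimes>\<^bsub>G\<^esub> y, z)
        = a \<otimes>\<^bsub>A\<^esub> b \<otimes>\<^bsub>A\<^esub> d \<otimes>\<^bsub>A\<^esub> (\<theta> (x, y) \<otimes>\<^bsub>A\<^esub> \<theta> (x \<otimes>\<^bsub>G\<^esub> y, z))"
      using m xyz c by (simp add: A.m_ac)
    also have "\<dots> = a \<otimes>\<^bsub>A\<^esub> (b \<otimes>\<^bsub>A\<^esub> d \<otimes>\<^bsub>A\<^esub> \<theta> (y, z)) \<otimes>\<^bsub>A\<^esub> \<theta> (x, y \<otimes>\<^bsub>G\<^esub> z)"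
      using m xyz c by (simp add: norm_cocycles2_cocycle[OF \<theta>] A.m_assoc)
    finally show "u \<otimes>\<^bsub>?E\<^esub> v \<otimes>\<^bsub>?E\<^esub> w = u \<otimes>\<^bsub>?E\<^esub> (v \<otimes>\<^bsub>?E\<^esub> w)"
      using xyz by (simp add: e G.m_assoc)
  next
    fix u assume "u \<in> carrier ?E"
    then obtain a x where u: "u = (a, x)" "a \<in> carrier A" "x \<in> carrier G" by auto
    let ?t = "\<theta> (inv\<^bsub>G\<^esub> x, x)"
    have "inv\<^bsub>A\<^esub> (a \<otimes>\<^bsub>A\<^esub> ?t) \<otimes>\<^bsub>A\<^esub> a \<otimes>\<^bsub>A\<^esub> ?t = \<one>\<^bsub>A\<^esub>"
      using u c by (simp add: A.m_assoc)
    then have "(inv\<^bsub>A\<^esub> (a \<otimes>\<^bsub>A\<^esub> ?t), inv\<^bsub>G\<^esub> x) \<otimes>\<^bsub>?E\<^esub> u = \<one>\<^bsub>?E\<^esub>"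
      using u by simp
    moreover have "(inv\<^bsub>A\<^esub> (a \<otimes>\<^bsub>A\<^esub> ?t), inv\<^bsub>G\<^esub> x) \<in> carrier ?E"
      using u c by simp
    ultimately show "\<exists>v\<in>carrier ?E. v \<otimes>\<^bsub>?E\<^esub> u = \<one>\<^bsub>?E\<^esub>" by blast
  qed simp
qed

text \<open>
  The formula makes \<open>(b, y)\<close> cancel against a right inverse, where \<open>\<theta> (y, y\<^sup>-\<^sup>1)\<close> appears; this is the
  source of the last factor in the definition of \<open>Phi2\<close>.
\<close>

lemma inv_central_extension:
  assumes "group G" "comm_group A" and \<theta>: "\<theta> \<in> norm_cocycles2 G A"
    and "b \<in> carrier A" "y \<in> carrier G"
  shows "inv\<^bsub>central_extension G A \<theta>\<^esub> (b, y)
    = (inv\<^bsub>A\<^esub> b \<otimes>\<^bsub>A\<^esub> inv\<^bsub>A\<^esub> \<theta> (y, inv\<^bsub>G\<^esub> y), inv\<^bsub>G\<^esub> y)" (is "inv\<^bsub>?E\<^esub> _ = ?v")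
proof -
  interpret G: group G by fact
  interpret A: comm_group A by fact
  interpret E: group ?E by (rule group_central_extension) fact+
  have t: "\<theta> (y, inv\<^bsub>G\<^esub> y) \<in> carrier A"
    using assms by (simp add: norm_cocycles2_closed)
  have "b \<otimes>\<^bsub>A\<^esub> (inv\<^bsub>A\<^esub> b \<otimes>\<^bsub>A\<^esub> inv\<^bsub>A\<^esub> \<theta> (y, inv\<^bsub>G\<^esub> y)) \<otimes>\<^bsub>A\<^esub> \<theta> (y, inv\<^bsub>G\<^esub> y) = \<one>\<^bsub>A\<^esub>"
    using t \<open>b \<in> carrier A\<close> by (simp add: A.m_assoc)
  then have "(b, y) \<otimes>\<^bsub>?E\<^esub> ?v = \<one>\<^bsub>?E\<^esub>"
    using assms by simp
  moreover have "(b, y) \<in> carrier ?E" "?v \<in> carrier ?E"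
    using assms t by auto
  ultimately show ?thesis
    using E.inv_comm E.inv_equality by blast
qed

section \<open>Heap brackets of section values\<close>

lemma Phi2_apply:
  assumes "x \<in> carrier G" "y \<in> carrier G" "z \<in> carrier G"
  shows "Phi2 G A \<theta> (x, y, z) =
    \<theta> (x, inv\<^bsub>G\<^esub> y) \<otimes>\<^bsub>A\<^esub> \<theta> (x \<otimes>\<^bsub>G\<^esub> inv\<^bsub>G\<^esub> y, z) \<otimes>\<^bsub>A\<^esub> inv\<^bsub>A\<^esub> \<theta> (y, inv\<^bsub>G\<^esub> y)"
  using assms by (simp add: Phi2_def triples_def)

lemma Phi2_closed:
  assumes "group G" "comm_group A" and \<theta>: "\<theta> \<in> norm_cocycles2 G A"
    and "x \<in> carrier G" "y \<in> carrier G" "z \<in> carrier G"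
  shows "Phi2 G A \<theta> (x, y, z) \<in> carrier A"
proof -
  interpret G: group G by fact
  interpret A: comm_group A by fact
  show ?thesis
    using assms by (simp add: Phi2_apply norm_cocycles2_closed)
qed

text \<open>
  With \<open>a = b = c = \<one>\<close> this identifies \<open>Phi2 G A \<theta>\<close> as the defect of the section \<open>x \<mapsto> (\<one>, x)\<close> with
  respect to heap brackets; nested brackets need the other values of \<open>a\<close>, \<open>b\<close>, \<open>c\<close>.
\<close>

lemma bracket_central_extension:
  assumes "group G" "comm_group A" and \<theta>: "\<theta> \<in> norm_cocycles2 G A"
    and abc: "a \<in> carrier A" "b \<in> carrier A" "c \<in> carrier A"
    and xyz: "x \<in> carrier G" "y \<in> carrier G" "z \<in> carrier G"
  shows "bracket (group_heap (central_extension G A \<theta>)) (a, x) (b, y) (c, z)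
    = (a \<otimes>\<^bsub>A\<^esub> inv\<^bsub>A\<^esub> b \<otimes>\<^bsub>A\<^esub> c \<otimes>\<^bsub>A\<^esub> Phi2 G A \<theta> (x, y, z), bracket (group_heap G) x y z)"
proof -
  interpret G: group G by fact
  interpret A: comm_group A by fact
  show ?thesis
    using abc xyz norm_cocycles2_closed[OF \<theta>]
    by (simp add: inv_central_extension[OF assms(1-3)] Phi2_apply A.m_ac)
qed

text \<open>
  Both conditions are the \<open>A\<close>-components of para-associativity in the central extension, evaluated at
  section values.
\<close>

lemma Phi2_cocycle:
  assumes "group G" "comm_group A" and \<theta>: "\<theta> \<in> norm_cocycles2 G A"
  shows "Phi2 G A \<theta> \<in> PA_cocycles2 (group_heap G) A"
proof -
  interpret G: group G by fact
  interpret A: comm_group A by fact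
  let ?X = "group_heap G"
  let ?H = "group_heap (central_extension G A \<theta>)"
  let ?\<eta> = "Phi2 G A \<theta>"
  interpret X: heap ?X by (rule heap_group_heap) fact
  interpret H: heap ?H by (intro heap_group_heap group_central_extension) fact+
  note c = Phi2_closed[OF assms]
  have br: "bracket ?X x y z \<in> carrier G"
    if "x \<in> carrier G" "y \<in> carrier G" "z \<in> carrier G" for x y z
    using that by simp
  note br_E = bracket_central_extension[OF assms]
  have cancel: "p \<otimes>\<^bsub>A\<^esub> q \<otimes>\<^bsub>A\<^esub> r \<otimes>\<^bsub>A\<^esub> inv\<^bsub>A\<^esub> s = \<one>\<^bsub>A\<^esub>"
    if "p \<otimes>\<^bsub>A\<^esub> q = inv\<^bsub>A\<^esub> r \<otimes>\<^bsub>A\<^esub> s" "p \<in> carrier A" "q \<in> carrier A" "r \<in> carrier A" "s \<in> carrier A"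
    for p q r s
  proof -
    have "p \<otimes>\<^bsub>A\<^esub> q \<otimes>\<^bsub>A\<^esub> r \<otimes>\<^bsub>A\<^esub> inv\<^bsub>A\<^esub> s = (r \<otimes>\<^bsub>A\<^esub> inv\<^bsub>A\<^esub> r) \<otimes>\<^bsub>A\<^esub> (s \<otimes>\<^bsub>A\<^esub> inv\<^bsub>A\<^esub> s)"
      unfolding that(1) using that(2-) by (simp only: A.m_ac A.m_closed A.inv_closed)
    then show ?thesis using that(2-) by simp
  qed
  have "?\<eta> (x1, x2, x3) \<otimes>\<^bsub>A\<^esub> ?\<eta> (bracket ?X x1 x2 x3, x4, x5) \<otimes>\<^bsub>A\<^esub> ?\<eta> (x4, x3, x2)
        \<otimes>\<^bsub>A\<^esub> inv\<^bsub>A\<^esub> ?\<eta> (x1, bracket ?X x4 x3 x2, x5) = \<one>\<^bsub>A\<^esub>" (is ?left)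
    and "?\<eta> (x3, x4, x5) \<otimes>\<^bsub>A\<^esub> ?\<eta> (x1, x2, bracket ?X x3 x4 x5) \<otimes>\<^bsub>A\<^esub> ?\<eta> (x4, x3, x2)
        \<otimes>\<^bsub>A\<^esub> inv\<^bsub>A\<^esub> ?\<eta> (x1, bracket ?X x4 x3 x2, x5) = \<one>\<^bsub>A\<^esub>" (is ?right)
    if x: "x1 \<in> carrier G" "x2 \<in> carrier G" "x3 \<in> carrier G" "x4 \<in> carrier G" "x5 \<in> carrier G"
    for x1 x2 x3 x4 x5
  proof -
    have "bracket ?H (bracket ?H (\<one>\<^bsub>A\<^esub>, x1) (\<one>\<^bsub>A\<^esub>, x2) (\<one>\<^bsub>A\<^esub>, x3)) (\<one>\<^bsub>A\<^esub>, x4) (\<one>\<^bsub>A\<^esub>, x5)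
        = bracket ?H (\<one>\<^bsub>A\<^esub>, x1) (bracket ?H (\<one>\<^bsub>A\<^esub>, x4) (\<one>\<^bsub>A\<^esub>, x3) (\<one>\<^bsub>A\<^esub>, x2)) (\<one>\<^bsub>A\<^esub>, x5)"
      by (rule H.para_assoc_left) (use x in simp_all)
    then have "?\<eta> (x1, x2, x3) \<otimes>\<^bsub>A\<^esub> ?\<eta> (bracket ?X x1 x2 x3, x4, x5)
        = inv\<^bsub>A\<^esub> ?\<eta> (x4, x3, x2) \<otimes>\<^bsub>A\<^esub> ?\<eta> (x1, bracket ?X x4 x3 x2, x5)"
      using x by (simp add: br_E br c del: group_heap_simps(2))
    then show ?left
      by (rule cancel) (intro c br x)+
    have "bracket ?H (\<one>\<^bsub>A\<^esub>, x1) (\<one>\<^bsub>A\<^esub>, x2) (bracket ?H (\<one>\<^bsub>A\<^esub>, x3) (\<one>\<^bsub>A\<^esub>, x4) (\<one>\<^bsub>A\<^esub>, x5))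
        = bracket ?H (\<one>\<^bsub>A\<^esub>, x1) (bracket ?H (\<one>\<^bsub>A\<^esub>, x4) (\<one>\<^bsub>A\<^esub>, x3) (\<one>\<^bsub>A\<^esub>, x2)) (\<one>\<^bsub>A\<^esub>, x5)"
      by (rule H.para_assoc_right) (use x in simp_all)
    then have "?\<eta> (x3, x4, x5) \<otimes>\<^bsub>A\<^esub> ?\<eta> (x1, x2, bracket ?X x3 x4 x5)
        = inv\<^bsub>A\<^esub> ?\<eta> (x4, x3, x2) \<otimes>\<^bsub>A\<^esub> ?\<eta> (x1, bracket ?X x4 x3 x2, x5)"
      using x by (simp add: br_E br c del: group_heap_simps(2))
    then show ?right
      by (rule cancel) (intro c br x)+
  qed
  then have "PA_d2_1 ?X A ?\<eta> = (\<lambda>_\<in>quintuples ?X. \<one>\<^bsub>A\<^esub>)" "PA_d2_2 ?X A ?\<eta> = (\<lambda>_\<in>quintuples ?X. \<one>\<^bsub>A\<^esub>)"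
    unfolding PA_d2_1_def PA_d2_2_def
    by (intro restrict_ext; force simp: quintuples_def simp del: group_heap_simps(2))+
  moreover have "?\<eta> \<in> triples ?X \<rightarrow>\<^sub>E carrier A"
    using norm_cocycles2_closed[OF \<theta>] by (auto simp: Phi2_def triples_def)
  ultimately show ?thesis
    by (simp add: PA_cocycles2_def)
qed

section \<open>The induced map on cohomology\<close>

lemma Phi2_hom:
  assumes "group G" "comm_group A"
  shows "Phi2 G A \<in> hom (norm_Z2 G A) (PA_Z2 (group_heap G) A)"
proof -
  interpret G: group G by fact
  interpret A: comm_group A by fact
  show ?thesis
  proof (rule homI)
    fix s assume "s \<in> carrier (norm_Z2 G A)"
    then show "Phi2 G A s \<in> carrier (PA_Z2 (group_heap G) A)"
      using Phi2_cocycle[OF assms] by (simp add: norm_Z2_def PA_Z2_def)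
  next
    fix s t assume "s \<in> carrier (norm_Z2 G A)" "t \<in> carrier (norm_Z2 G A)"
    then have "s \<in> norm_cocycles2 G A" "t \<in> norm_cocycles2 G A"
      by (simp_all add: norm_Z2_def)
    from this[THEN norm_cocycles2_closed]
    show "Phi2 G A (s \<otimes>\<^bsub>norm_Z2 G A\<^esub> t) = Phi2 G A s \<otimes>\<^bsub>PA_Z2 (group_heap G) A\<^esub> Phi2 G A t"
      by (auto simp: norm_Z2_def PA_Z2_def Phi2_def triples_def fun_eq_iff A.inv_mult A.m_ac)
  qed
qed

text \<open>
  In \<open>Phi2\<close> of a coboundary the values of \<open>f\<close> at \<open>y\<^sup>-\<^sup>1\<close> and \<open>x y\<^sup>-\<^sup>1\<close> cancel, and \<open>f \<one> = \<one>\<close> removes the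
  value at \<open>y y\<^sup>-\<^sup>1\<close>. What remains is \<open>f x - f y + f z - f [x, y, z]\<close> in additive notation.
\<close>

lemma Phi2_group_d1:
  assumes "group G" "comm_group A" and f: "f \<in> norm_cochains1 G A"
  shows "Phi2 G A (group_d1 G A f) = PA_d1 (group_heap G) A (\<lambda>x\<in>carrier G. inv\<^bsub>A\<^esub> f x)"
proof -
  interpret G: group G by fact
  interpret A: comm_group A by fact
  have c: "f x \<in> carrier A" if "x \<in> carrier G" for x
    using f that by (auto simp: norm_cochains1_def)
  have f1: "f \<one>\<^bsub>G\<^esub> = \<one>\<^bsub>A\<^esub>"
    using f by (simp add: norm_cochains1_def)
  have cancel: "(a \<otimes>\<^bsub>A\<^esub> q \<otimes>\<^bsub>A\<^esub> inv\<^bsub>A\<^esub> p) \<otimes>\<^bsub>A\<^esub> (p \<otimes>\<^bsub>A\<^esub> d \<otimes>\<^bsub>A\<^esub> inv\<^bsub>A\<^esub> r) \<otimes>\<^bsub>A\<^esub> inv\<^bsub>A\<^esub> (b \<otimes>\<^bsub>A\<^esub> q)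
      = inv\<^bsub>A\<^esub> r \<otimes>\<^bsub>A\<^esub> a \<otimes>\<^bsub>A\<^esub> inv\<^bsub>A\<^esub> b \<otimes>\<^bsub>A\<^esub> d" (is "?l = ?r")
    if v: "a \<in> carrier A" "b \<in> carrier A" "d \<in> carrier A" "p \<in> carrier A" "q \<in> carrier A"
      "r \<in> carrier A" for a b d p q r
  proof -
    have "?l = (p \<otimes>\<^bsub>A\<^esub> inv\<^bsub>A\<^esub> p) \<otimes>\<^bsub>A\<^esub> (q \<otimes>\<^bsub>A\<^esub> inv\<^bsub>A\<^esub> q) \<otimes>\<^bsub>A\<^esub> ?r"
      using v by (simp only: A.inv_mult A.m_ac A.m_closed A.inv_closed)
    then show ?thesis using v by simp
  qed
  show ?thesis
    unfolding Phi2_def PA_d1_def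
    by (rule restrict_ext) (auto simp: triples_def group_d1_def f1 c cancel)
qed

lemma Phi2_coboundaries:
  assumes "group G" "comm_group A"
  shows "Phi2 G A ` norm_coboundaries2 G A \<subseteq> PA_coboundaries2 (group_heap G) A"
proof -
  interpret A: comm_group A by fact
  have "Phi2 G A (group_d1 G A f) \<in> PA_coboundaries2 (group_heap G) A"
    if f: "f \<in> norm_cochains1 G A" for f
  proof -
    have "(\<lambda>x\<in>carrier G. inv\<^bsub>A\<^esub> f x) \<in> carrier (group_heap G) \<rightarrow>\<^sub>E carrier A"
      using f by (auto simp: norm_cochains1_def)
    then show ?thesis
      by (simp add: Phi2_group_d1[OF assms f] PA_coboundaries2_def)
  qed
  then show ?thesis
    by (auto simp: norm_coboundaries2_def)
qed

text \<open>
  The composite of \<open>h\<close> with the projection onto \<open>W Mod C\<close> kills \<open>B\<close>, so it factors through \<open>Z Mod B\<close>.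
  The cosets \<open>B #> x\<close> exhaust \<open>Z Mod B\<close>, so the factorization is determined on the carrier, and
  extensionality fixes its junk values elsewhere.
\<close>

lemma FactGroup_induced_hom:
  assumes B: "B \<lhd> Z" and C: "C \<lhd> W" and h: "h \<in> hom Z W" and "h ` B \<subseteq> C"
  shows "\<exists>!g. g \<in> extensional (carrier (Z Mod B)) \<and> g \<in> hom (Z Mod B) (W Mod C) \<and>
    (\<forall>x\<in>carrier Z. g (B #>\<^bsub>Z\<^esub> x) = C #>\<^bsub>W\<^esub> h x)"
proof -
  interpret B: normal B Z by fact
  interpret C: normal C W by fact
  let ?k = "(\<lambda>y. C #>\<^bsub>W\<^esub> y) \<circ> h"
  have k: "?k \<in> hom Z (W Mod C)"
    using hom_compose[OF h C.r_coset_hom_Mod] .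
  interpret k: group_hom Z "W Mod C" ?k
    using k by (intro group_hom.intro group_hom_axioms.intro B.is_group C.factorgroup_is_group)
  have "B \<subseteq> kernel Z (W Mod C) ?k"
    using \<open>h ` B \<subseteq> C\<close> B.subset by (auto simp: kernel_def C.rcos_const)
  then obtain g where g: "g \<in> hom (Z Mod B) (W Mod C)"
      "\<And>x. x \<in> carrier Z \<Longrightarrow> g (B #>\<^bsub>Z\<^esub> x) = C #>\<^bsub>W\<^esub> h x"
    using k.FactGroup_universal_kernel[OF B] by auto
  show ?thesis
  proof (rule ex1I)
    let ?g = "restrict g (carrier (Z Mod B))"
    have "?g \<in> hom (Z Mod B) (W Mod C)"
      using g(1) group.is_monoid[OF B.factorgroup_is_group] monoid.m_closed
      by (fastforce simp: hom_def)
    then show "?g \<in> extensional (carrier (Z Mod B)) \<and> ?g \<in> hom (Z Mod B) (W Mod C) \<and>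
        (\<forall>x\<in>carrier Z. ?g (B #>\<^bsub>Z\<^esub> x) = C #>\<^bsub>W\<^esub> h x)"
      using g(2) by (auto simp: carrier_FactGroup)
  next
    fix g' assume g': "g' \<in> extensional (carrier (Z Mod B)) \<and> g' \<in> hom (Z Mod B) (W Mod C) \<and>
        (\<forall>x\<in>carrier Z. g' (B #>\<^bsub>Z\<^esub> x) = C #>\<^bsub>W\<^esub> h x)"
    show "g' = restrict g (carrier (Z Mod B))"
      by (rule extensionalityI) (use g' g(2) in \<open>auto simp: carrier_FactGroup\<close>)
  qed
qed

theorem theorem4p7:
  fixes G :: "('g, 'm) monoid_scheme" and A :: "('a, 'n) monoid_scheme"
  assumes "group G" and "comm_group A"
  shows "(\<forall>\<theta>\<in>norm_cocycles2 G A. Phi2 G A \<theta> \<in> PA_cocycles2 (group_heap G) A) \<and>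
    (\<exists>!Phi2_bar. Phi2_bar \<in> extensional (carrier (norm_H2 G A)) \<and>
      Phi2_bar \<in> hom (norm_H2 G A) (PA_H2 (group_heap G) A) \<and>
      (\<forall>\<theta>\<in>norm_cocycles2 G A.
        Phi2_bar (norm_class G A \<theta>) = PA_class (group_heap G) A (Phi2 G A \<theta>)))"
proof -
  interpret X: heap "group_heap G" by (rule heap_group_heap) fact
  have "norm_coboundaries2 G A \<lhd> norm_Z2 G A"
    using comm_group_norm_H2[OF assms] by (simp add: comm_group.normal_iff_subgroup)
  moreover have "PA_coboundaries2 (group_heap G) A \<lhd> PA_Z2 (group_heap G) A"
    using X.comm_group_PA_H2[OF assms(2)] by (simp add: comm_group.normal_iff_subgroup)
  moreover have "carrier (norm_Z2 G A) = norm_cocycles2 G A"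
    by (simp add: norm_Z2_def)
  ultimately show ?thesis
    using FactGroup_induced_hom[OF _ _ Phi2_hom[OF assms] Phi2_coboundaries[OF assms]]
      Phi2_cocycle[OF assms]
    by (simp add: norm_H2_def PA_H2_def norm_class_def PA_class_def)
qed

end
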